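(* Let $m \in \mathbb{N}$, $m\ge 1$, and let $(V_i)_{i=1}^m$ be a collection of pairwise disjoint, non-empty finite sets of vertices. The number $N_{m}$ of distinct rooted forests on the collection $(V_{i})_{i=1}^{m}$ is given by $$N_{m} = \vert V_{1}\vert \left(\sum_{i=1}^{m} \vert V_{i}\vert\right)^{m-2} \prod_{i=2}^{m} \left(2^{\vert V_{i} \vert}-1\right).$$
   Context: Definition (rooted, or directed, forest on a collection of sets of vertices). Let $(V_i)_{i=1}^m$ be a collection of pairwise disjoint, non-empty finite sets. A rooted forest on $(V_i)_{i=1}^m$ is a (simple, undirected) graph on the vertex set $V=V_1\cup\dots\cup V_m$ such that: (1) its connected components are trees (isolated vertices being allowed); (2) there are no edges between two vertices of the same set $V_j$; (3) the reduced graph, obtained by collapsing each set $V_j$ to a single point and collapsing all edges between two given sets $V_i$ and $V_j$ to a single edge, is a single connected tree (on the $m$ points $1,\dots,m$); (4) for every $j\ge 2$, if $V_i$ is the set adjacent to $V_j$ on the path from $V_j$ to $V_1$ in the reduced tree, then all edges between $V_i$ and $V_j$ emanate from a single vertex of $V_i$ (called a root). Two rooted forests are distinct if they have different edge sets (vertices are labelled). Empty products equal $1$; for $m=1$ the exponent $m-2=-1$ is understood as a reciprocal. *)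

theory Defs
  imports Complex_Main "HOL-Library.Disjoint_Sets"
begin

text \<open>
  A simple undirected graph is given by a vertex set and a set of two-element sets of vertices.
  The notions \<open>forest\<close> and \<open>tree\<close> of the AFP entry Graph-Theory are not used: they only exclude
  directed cycles, so with each undirected edge represented by two opposite arcs
  no graph with an edge would be a tree.
\<close>

definition simple_graph :: "'a set \<Rightarrow> 'a set set \<Rightarrow> bool" where
  "simple_graph V E \<longleftrightarrow> (\<forall>e\<in>E. e \<subseteq> V \<and> card e = 2)"

definition walk :: "'a set \<Rightarrow> 'a set set \<Rightarrow> 'a list \<Rightarrow> bool" where
  "walk V E p \<longleftrightarrow> p \<noteq> [] \<and> set p \<subseteq> V \<and> successively (\<lambda>u v. {u, v} \<in> E) p"

definition walk_betw :: "'a set \<Rightarrow> 'a set set \<Rightarrow> 'a \<Rightarrow> 'a list \<Rightarrow> 'a \<Rightarrow> bool" where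
  "walk_betw V E u p v \<longleftrightarrow> walk V E p \<and> hd p = u \<and> last p = v"

definition path_betw :: "'a set \<Rightarrow> 'a set set \<Rightarrow> 'a \<Rightarrow> 'a list \<Rightarrow> 'a \<Rightarrow> bool" where
  "path_betw V E u p v \<longleftrightarrow> walk_betw V E u p v \<and> distinct p"

text \<open>A cycle is listed without repeating its first vertex at the end.\<close>

definition cycle :: "'a set \<Rightarrow> 'a set set \<Rightarrow> 'a list \<Rightarrow> bool" where
  "cycle V E p \<longleftrightarrow> walk V E p \<and> distinct p \<and> length p \<ge> 3 \<and> {last p, hd p} \<in> E"

definition connected_graph :: "'a set \<Rightarrow> 'a set set \<Rightarrow> bool" where
  "connected_graph V E \<longleftrightarrow> V \<noteq> {} \<and> (\<forall>u\<in>V. \<forall>v\<in>V. \<exists>p. walk_betw V E u p v)"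

definition tree :: "'a set \<Rightarrow> 'a set set \<Rightarrow> bool" where
  "tree V E \<longleftrightarrow> simple_graph V E \<and> connected_graph V E \<and> (\<nexists>p. cycle V E p)"

definition components :: "'a set \<Rightarrow> 'a set set \<Rightarrow> 'a set set" where
  "components V E = (\<lambda>u. {v \<in> V. \<exists>p. walk_betw V E u p v}) ` V"

definition induced_edges :: "'a set set \<Rightarrow> 'a set \<Rightarrow> 'a set set" where
  "induced_edges E C = {e \<in> E. e \<subseteq> C}"

text \<open>The reduced graph has vertex set \<open>{1..m}\<close>, the point \<open>i\<close> standing for the collapsed set \<open>V i\<close>.\<close>

definition reduced_edges :: "nat \<Rightarrow> (nat \<Rightarrow> 'a set) \<Rightarrow> 'a set set \<Rightarrow> nat set set" where
  "reduced_edges m V E =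
     {{i, j} | i j. i \<in> {1..m} \<and> j \<in> {1..m} \<and> i \<noteq> j \<and> (\<exists>u\<in>V i. \<exists>v\<in>V j. {u, v} \<in> E)}"

text \<open>
  In the last conjunct, \<open>p ! 1\<close> is the neighbour of \<open>j\<close> on the path \<open>p\<close> from \<open>j\<close> to \<open>1\<close>;
  this path exists and is unique because the reduced graph is a tree.
\<close>

definition rooted_forest :: "nat \<Rightarrow> (nat \<Rightarrow> 'a set) \<Rightarrow> 'a set set \<Rightarrow> bool" where
  "rooted_forest m V E \<longleftrightarrow>
     simple_graph (\<Union>i\<in>{1..m}. V i) E \<and>
     (\<forall>C\<in>components (\<Union>i\<in>{1..m}. V i) E. tree C (induced_edges E C)) \<and>
     (\<forall>j\<in>{1..m}. \<forall>u\<in>V j. \<forall>v\<in>V j. {u, v} \<notin> E) \<and>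
     tree {1..m} (reduced_edges m V E) \<and>
     (\<forall>j\<in>{2..m}. \<forall>p. path_betw {1..m} (reduced_edges m V E) j p 1 \<longrightarrow>
        (\<exists>r\<in>V (p ! 1). \<forall>u\<in>V (p ! 1). \<forall>v\<in>V j. {u, v} \<in> E \<longrightarrow> u = r))"

end

theory Submission
  imports Defs
begin

text \<open>
  A rooted forest amounts to two independent choices: the root \<open>f i\<close> to which each \<open>V i\<close> with
  \<open>i \<ge> 2\<close> is attached, such that iterating \<open>i \<mapsto>\<close> (index of the set containing \<open>f i\<close>) leads to \<open>1\<close>,
  and the non-empty subset of \<open>V i\<close> joined to \<open>f i\<close>. The acyclicity of the graph is then automatic,
  since each vertex has at most one neighbour in a set closer to \<open>V 1\<close>. The second choice gives the
  product of the \<open>2 ^ card (V i) - 1\<close>. The maps \<open>f\<close> are counted by a weighted Cayley formula, by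
  induction over the set of indices \<open>i\<close> attached directly to \<open>V 1\<close>: removing them leaves the same
  problem, with their sets in the place of \<open>V 1\<close>.
\<close>

section \<open>A weighted Cayley formula\<close>

text \<open>The rank \<open>d\<close> expresses that every chain of attachments ends in the root set \<open>R\<close>.\<close>

definition attachments :: "('i \<Rightarrow> 'a set) \<Rightarrow> 'i set \<Rightarrow> 'a set \<Rightarrow> ('i \<Rightarrow> 'a) set" where
  "attachments V A R =
     {f \<in> A \<rightarrow>\<^sub>E R \<union> \<Union> (V ` A). \<exists>d :: 'i \<Rightarrow> nat. \<forall>i\<in>A. \<forall>k\<in>A. f i \<in> V k \<longrightarrow> d k < d i}"

lemma attachments_empty [simp]: "attachments V {} R = {\<lambda>_. undefined}"
  by (auto simp: attachments_def)

lemma finite_attachments: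
  assumes "finite A" "finite R" "\<And>i. i \<in> A \<Longrightarrow> finite (V i)"
  shows "finite (attachments V A R)"
proof -
  have "finite (A \<rightarrow>\<^sub>E R \<union> \<Union> (V ` A))"
    using assms by (intro finite_PiE) auto
  then show ?thesis
    by (rule rev_finite_subset) (auto simp: attachments_def)
qed

text \<open>An index of least rank cannot be attached to a set \<open>V k\<close> with
  \<open>k\<close> in \<open>A\<close>, so its value lies in \<open>R\<close>.\<close>

lemma attachments_meet_root:
  assumes "finite A" "A \<noteq> {}" "f \<in> attachments V A R"
  shows "\<exists>i\<in>A. f i \<in> R"
proof (rule ccontr)
  assume no: "\<not> ?thesis"
  obtain d :: "'a \<Rightarrow> nat" where d: "\<forall>i\<in>A. \<forall>k\<in>A. f i \<in> V k \<longrightarrow> d k < d i"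
    and f: "f \<in> A \<rightarrow>\<^sub>E R \<union> \<Union> (V ` A)"
    using assms(3) unfolding attachments_def by blast
  define i where "i = arg_min_on d A"
  have i: "i \<in> A" "\<And>k. k \<in> A \<Longrightarrow> d i \<le> d k"
    using assms arg_min_if_finite[of A d] arg_min_least[of A _ d] unfolding i_def by auto
  obtain k where "k \<in> A" "f i \<in> V k"
    using f no i(1) by (auto simp: PiE_iff)
  with d i show False by (meson leD)
qed

text \<open>Once the set \<open>S\<close> of indices attached directly to \<open>R\<close> is fixed,
  their values in \<open>R\<close> are arbitrary, and the remaining indices form an attachment
  problem whose root set is the union of the \<open>V i\<close> with \<open>i\<close> in
  \<open>S\<close>. Gluing the two parts is the inverse map.\<close>

lemma bij_betw_attachments_fibre:
  assumes S: "S \<subseteq> A" and dj: "disjoint_family_on V A"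
    and R: "\<And>i. i \<in> A \<Longrightarrow> R \<inter> V i = {}"
  shows "bij_betw (\<lambda>f. (restrict f S, restrict f (A - S)))
           {f \<in> attachments V A R. {i \<in> A. f i \<in> R} = S}
           ((S \<rightarrow>\<^sub>E R) \<times> attachments V (A - S) (\<Union> (V ` S)))"
proof (rule bij_betw_byWitness[where f' = "\<lambda>(g, h) i. if i \<in> S then g i else h i"])
  show "\<forall>f\<in>{f \<in> attachments V A R. {i \<in> A. f i \<in> R} = S}.
    (case (restrict f S, restrict f (A - S)) of (g, h) \<Rightarrow> \<lambda>i. if i \<in> S then g i else h i) = f"
    using S by (auto simp: attachments_def fun_eq_iff PiE_iff extensional_def)
  show "\<forall>gh\<in>(S \<rightarrow>\<^sub>E R) \<times> attachments V (A - S) (\<Union> (V ` S)).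
    (restrict (case gh of (g, h) \<Rightarrow> \<lambda>i. if i \<in> S then g i else h i) S,
     restrict (case gh of (g, h) \<Rightarrow> \<lambda>i. if i \<in> S then g i else h i) (A - S)) = gh"
    using S by (auto simp: attachments_def fun_eq_iff PiE_iff extensional_def)
  show "(\<lambda>f. (restrict f S, restrict f (A - S))) `
      {f \<in> attachments V A R. {i \<in> A. f i \<in> R} = S}
    \<subseteq> (S \<rightarrow>\<^sub>E R) \<times> attachments V (A - S) (\<Union> (V ` S))"
  proof (rule image_subsetI)
    fix f assume "f \<in> {f \<in> attachments V A R. {i \<in> A. f i \<in> R} = S}"
    then have f: "f \<in> attachments V A R" and Seq: "S = {i \<in> A. f i \<in> R}" by auto
    obtain d :: "'a \<Rightarrow> nat" where d: "\<forall>i\<in>A. \<forall>k\<in>A. f i \<in> V k \<longrightarrow> d k < d i"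
      and fA: "f \<in> A \<rightarrow>\<^sub>E R \<union> \<Union> (V ` A)"
      using f unfolding attachments_def by blast
    \<comment> \<open>Outside \<open>S\<close> the values avoid \<open>R\<close>, so they lie in
      sets \<open>V k\<close>, whose indices split into \<open>S\<close> and
      \<open>A - S\<close>.\<close>
    have "restrict f (A - S) \<in> A - S \<rightarrow>\<^sub>E \<Union> (V ` S) \<union> \<Union> (V ` (A - S))"
      using fA Seq by (auto simp: PiE_iff)
    moreover have "\<forall>i\<in>A - S. \<forall>k\<in>A - S. restrict f (A - S) i \<in> V k \<longrightarrow> d k < d i"
      using d by auto
    ultimately have "restrict f (A - S) \<in> attachments V (A - S) (\<Union> (V ` S))"
      unfolding attachments_def by blast
    then show "(restrict f S, restrict f (A - S))
        \<in> (S \<rightarrow>\<^sub>E R) \<times> attachments V (A - S) (\<Union> (V ` S))"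
      by (auto simp: Seq)
  qed
  show "(\<lambda>(g, h) i. if i \<in> S then g i else h i) `
      ((S \<rightarrow>\<^sub>E R) \<times> attachments V (A - S) (\<Union> (V ` S)))
    \<subseteq> {f \<in> attachments V A R. {i \<in> A. f i \<in> R} = S}"
  proof clarify
    fix g h assume g: "g \<in> S \<rightarrow>\<^sub>E R" and h: "h \<in> attachments V (A - S) (\<Union> (V ` S))"
    define f where "f = (\<lambda>i. if i \<in> S then g i else h i)"
    obtain d :: "'a \<Rightarrow> nat" where d: "\<forall>i\<in>A - S. \<forall>k\<in>A - S. h i \<in> V k \<longrightarrow> d k < d i"
      and hA: "h \<in> A - S \<rightarrow>\<^sub>E \<Union> (V ` S) \<union> \<Union> (V ` (A - S))"
      using h unfolding attachments_def by blast
    \<comment> \<open>The first layer gets rank 0 and the others move up by one, above everything in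
      \<open>S\<close>. The values on \<open>S\<close> lie in \<open>R\<close>, which meets no
      \<open>V k\<close>, so they impose no condition.\<close>
    define d' where "d' = (\<lambda>i. if i \<in> S then 0 else Suc (d i))"
    have "f \<in> A \<rightarrow>\<^sub>E R \<union> \<Union> (V ` A)"
    proof (rule PiE_I)
      fix i assume "i \<in> A"
      then show "f i \<in> R \<union> \<Union> (V ` A)"
        using PiE_mem[OF g, of i] PiE_mem[OF hA, of i] S by (auto simp: f_def)
    next
      fix i assume "i \<notin> A"
      then show "f i = undefined"
        using PiE_arb[OF hA, of i] S by (auto simp: f_def)
    qed
    moreover have "\<forall>i\<in>A. \<forall>k\<in>A. f i \<in> V k \<longrightarrow> d' k < d' i"
      using d PiE_mem[OF g] R S by (fastforce simp: f_def d'_def)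
    ultimately have "f \<in> attachments V A R"
      unfolding attachments_def by blast
    \<comment> \<open>The values of \<open>h\<close> lie in sets \<open>V k\<close>, which are
      disjoint from \<open>R\<close>; hence no index outside \<open>S\<close> joins the first
      layer.\<close>
    moreover have "h i \<notin> R" if "i \<in> A - S" for i
      using that PiE_mem[OF hA that] R S by fastforce
    then have "{i \<in> A. f i \<in> R} = S"
      using g S by (auto simp: f_def PiE_iff)
    ultimately show "f \<in> attachments V A R \<and> {i \<in> A. f i \<in> R} = S"
      by blast
  qed
qed

text \<open>After exchanging the sums, \<open>i\<close> contributes \<open>w i\<close> times a
  binomial sum over the subsets containing \<open>i\<close>, which is
  \<open>r * (r + W) ^ (card A - 1)\<close>. The factor \<open>r + W\<close> restores the exponent
  \<open>card A\<close>.\<close>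

lemma sum_Pow_power_weight:
  fixes r W :: nat and w :: "'i \<Rightarrow> nat"
  assumes "finite A"
  shows "(\<Sum>S\<in>Pow A. r ^ card S * sum w S * W ^ (card A - card S)) * (r + W)
           = sum w A * r * (r + W) ^ card A"
proof -
  have inner: "(\<Sum>S\<in>Pow A. if i \<in> S then r ^ card S * W ^ (card A - card S) else 0)
      = r * (r + W) ^ (card A - 1)" if i: "i \<in> A" for i
  proof -
    have "(\<Sum>S\<in>Pow A. if i \<in> S then r ^ card S * W ^ (card A - card S) else 0)
        = (\<Sum>S\<in>Pow A. (\<Prod>x\<in>S. r) * (\<Prod>x\<in>A - S. if x = i then 0 else W))"
    proof (rule sum.cong)
      fix S assume S: "S \<in> Pow A"
      have fin: "finite (A - S)" "finite S" using S assms by (auto intro: finite_subset)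
      show "(if i \<in> S then r ^ card S * W ^ (card A - card S) else 0)
          = (\<Prod>x\<in>S. r) * (\<Prod>x\<in>A - S. if x = i then 0 else W)"
      proof (cases "i \<in> S")
        case True
        have "(\<Prod>x\<in>A - S. if x = i then 0 else W) = (\<Prod>x\<in>A - S. W)"
          using True by (intro prod.cong) auto
        then show ?thesis using True S fin by (simp add: card_Diff_subset)
      next
        case False
        then have "(\<Prod>x\<in>A - S. if x = i then 0 else W) = 0"
          using i fin by (intro prod_zero) auto
        then show ?thesis using False by simp
      qed
    qed simp
    also have "\<dots> = (\<Prod>x\<in>A. r + (if x = i then 0 else W))"
      using assms by (simp add: prod_add)
    also have "\<dots> = r * (\<Prod>x\<in>A - {i}. r + W)"
      using assms i by (subst prod.remove[of _ i]) (auto intro!: prod.cong)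
    also have "\<dots> = r * (r + W) ^ (card A - 1)"
      using assms i by simp
    finally show ?thesis .
  qed
  have "(\<Sum>S\<in>Pow A. r ^ card S * sum w S * W ^ (card A - card S))
      = (\<Sum>S\<in>Pow A. \<Sum>i\<in>A. w i * (if i \<in> S then r ^ card S * W ^ (card A - card S) else 0))"
  proof (rule sum.cong)
    fix S assume "S \<in> Pow A"
    then have "sum w S = (\<Sum>i\<in>A. if i \<in> S then w i else 0)"
      using assms by (simp add: sum.If_cases Int_absorb1)
    then show "r ^ card S * sum w S * W ^ (card A - card S)
        = (\<Sum>i\<in>A. w i * (if i \<in> S then r ^ card S * W ^ (card A - card S) else 0))"
      by (simp add: sum_distrib_left sum_distrib_right if_distrib mult_ac cong: if_cong)
  qed simp
  also have "\<dots> = (\<Sum>i\<in>A. w i * (r * (r + W) ^ (card A - 1)))"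
    by (subst sum.swap) (simp add: sum_distrib_left[symmetric] inner)
  also have "\<dots> = sum w A * (r * (r + W) ^ (card A - 1))"
    by (simp add: sum_distrib_right)
  finally show ?thesis
    \<comment> \<open>For empty \<open>A\<close> the exponent \<open>card A - 1\<close> is
      truncated, but both sides vanish because \<open>sum w A = 0\<close>.\<close>
    using assms by (cases "A = {}") (simp_all add: power_eq_if mult_ac)
qed

text \<open>
  Both sides carry an extra factor, the total number of vertices,
  so that the exponent does not become negative for empty \<open>A\<close>.
\<close>

lemma card_attachments:
  assumes "finite A" "disjoint_family_on V A" "finite R"
    and "\<And>i. i \<in> A \<Longrightarrow> finite (V i) \<and> V i \<noteq> {} \<and> R \<inter> V i = {}"
  shows "card (attachments V A R) * (card R + (\<Sum>i\<in>A. card (V i)))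
           = card R * (card R + (\<Sum>i\<in>A. card (V i))) ^ card A"
  using assms
proof (induction "card A" arbitrary: A R rule: less_induct)
  case less
  show ?case
  proof (cases "A = {}")
    case True
    then show ?thesis by simp
  next
    case False
    define W where "W = (\<Sum>i\<in>A. card (V i))"
    define r where "r = card R"
    obtain a where "a \<in> A" using False by blast
    then have W: "W > 0"
      unfolding W_def using less.prems
      by (intro sum_pos2[of _ a]) (auto simp: card_gt_0_iff)
    \<comment> \<open>The factor \<open>W\<close> is the total size in the subproblem left by
      \<open>S\<close>, whatever \<open>S\<close> is, so the induction hypothesis applies in its
      multiplied form.\<close>
    have fibre: "card {f \<in> attachments V A R. {i \<in> A. f i \<in> R} = S} * W
        = r ^ card S * (\<Sum>i\<in>S. card (V i)) * W ^ (card A - card S)"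
      if S: "S \<in> Pow A" for S
    proof (cases "S = {}")
      case True
      \<comment> \<open>With an empty first layer both sides are 0: no attachment misses
        \<open>R\<close>, and the sum over \<open>S\<close> is empty.\<close>
      then have "{f \<in> attachments V A R. {i \<in> A. f i \<in> R} = S} = {}"
        using attachments_meet_root[OF less.prems(1) False] by blast
      with True show ?thesis by (simp only: card.empty) simp
    next
      case ne: False
      have fS: "finite S" using S less.prems(1) by (auto intro: finite_subset)
      have disj: "disjoint_family_on V S" "disjoint_family_on V (A - S)"
        using less.prems(2) S by (auto simp: disjoint_family_on_def)
      have cardS: "card (\<Union> (V ` S)) = (\<Sum>i\<in>S. card (V i))"
        using fS S disj(1) less.prems(4)
        by (intro card_UN_disjoint) (auto simp: disjoint_family_on_def)
      have tot: "(\<Sum>i\<in>S. card (V i)) + (\<Sum>i\<in>A - S. card (V i)) = W"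
        unfolding W_def using S less.prems(1)
        by (simp add: sum.subset_diff[of S A] add.commute)
      have less_card: "card (A - S) < card A"
        using S ne less.prems(1) by (intro psubset_card_mono) auto
      have "\<Union> (V ` S) \<inter> V i = {}" if "i \<in> A - S" for i
      proof -
        have "V k \<inter> V i = {}" if "k \<in> S" for k
          using that \<open>i \<in> A - S\<close> S disjoint_family_onD[OF less.prems(2), of k i] by auto
        then show ?thesis by blast
      qed
      then have IH: "card (attachments V (A - S) (\<Union> (V ` S))) * W
          = (\<Sum>i\<in>S. card (V i)) * W ^ card (A - S)"
        using less.hyps[OF less_card, of "\<Union> (V ` S)"] less.prems(1,4) fS disj S
        by (simp add: cardS tot subset_iff)
      have "card {f \<in> attachments V A R. {i \<in> A. f i \<in> R} = S}
          = card ((S \<rightarrow>\<^sub>E R) \<times> attachments V (A - S) (\<Union> (V ` S)))"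
        using S less.prems by (intro bij_betw_same_card[OF bij_betw_attachments_fibre]) auto
      also have "\<dots> = r ^ card S * card (attachments V (A - S) (\<Union> (V ` S)))"
        using fS by (simp add: card_cartesian_product card_PiE r_def)
      finally show ?thesis
        using IH S fS by (simp add: card_Diff_subset)
    qed
    have "card (attachments V A R)
        = (\<Sum>S\<in>Pow A. card {f \<in> attachments V A R. {i \<in> A. f i \<in> R} = S})"
    proof -
      have "attachments V A R = (\<Union>S\<in>Pow A. {f \<in> attachments V A R. {i \<in> A. f i \<in> R} = S})"
      proof (intro equalityI subsetI)
        fix f assume "f \<in> attachments V A R"
        then show "f \<in> (\<Union>S\<in>Pow A. {f \<in> attachments V A R. {i \<in> A. f i \<in> R} = S})"
          by (intro UN_I[of "{i \<in> A. f i \<in> R}"]) auto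
      qed blast
      then have "card (attachments V A R)
          = card (\<Union>S\<in>Pow A. {f \<in> attachments V A R. {i \<in> A. f i \<in> R} = S})"
        by (rule arg_cong)
      also have "\<dots> = (\<Sum>S\<in>Pow A. card {f \<in> attachments V A R. {i \<in> A. f i \<in> R} = S})"
        using less.prems by (intro card_UN_disjoint) (auto simp: finite_attachments)
      finally show ?thesis .
    qed
    then have "card (attachments V A R) * W
        = (\<Sum>S\<in>Pow A. r ^ card S * (\<Sum>i\<in>S. card (V i)) * W ^ (card A - card S))"
      by (simp only: sum_distrib_right) (intro sum.cong fibre refl)
    \<comment> \<open>With weights \<open>card (V i)\<close> the sum of the weights is
      \<open>W\<close> again, so the auxiliary factor \<open>W\<close> can be cancelled.\<close>
    then have "card (attachments V A R) * W * (r + W) = W * r * (r + W) ^ card A"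
      using sum_Pow_power_weight[OF less.prems(1), where r = r and w = "\<lambda>i. card (V i)" and W = W]
      by (simp add: W_def[symmetric])
    then have "W * (card (attachments V A R) * (r + W)) = W * (r * (r + W) ^ card A)"
      by (simp only: mult_ac)
    then show ?thesis
      using W by (simp only: mult_cancel1 W_def[symmetric] r_def[symmetric]) simp
  qed
qed

section \<open>Paths and trees\<close>

text \<open>Turns walks into a reflexive transitive closure, for induction on reachability. Both
  endpoints are required in \<open>V\<close> because walks stay in \<open>V\<close>.\<close>

definition adj :: "'a set \<Rightarrow> 'a set set \<Rightarrow> 'a \<Rightarrow> 'a \<Rightarrow> bool" where
  "adj V E x y \<longleftrightarrow> x \<in> V \<and> y \<in> V \<and> {x, y} \<in> E"

lemma adj_rtranclp_sym:
  assumes "(adj V E)\<^sup>*\<^sup>* u v"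
  shows "(adj V E)\<^sup>*\<^sup>* v u"
proof -
  have "symp (adj V E)"
    by (auto simp: symp_def adj_def insert_commute)
  then show ?thesis
    using assms by (metis symp_rtranclp sympD)
qed

lemma walk_Cons:
  "walk V E (x # p) \<longleftrightarrow> x \<in> V \<and> (p = [] \<or> {x, hd p} \<in> E \<and> walk V E p)"
  by (cases p) (auto simp: walk_def)

lemma walk_append2: "walk V E (p @ q) \<Longrightarrow> q \<noteq> [] \<Longrightarrow> walk V E q"
  by (auto simp: walk_def successively_append_iff)

lemma walk_rev [simp]: "walk V E (rev p) \<longleftrightarrow> walk V E p"
  by (simp add: walk_def successively_rev insert_commute)

lemma walk_betw_imp_adj:
  assumes "walk_betw V E u p v"
  shows "u \<in> V \<and> v \<in> V \<and> (adj V E)\<^sup>*\<^sup>* u v"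
  using assms
proof (induction p arbitrary: u)
  case Nil
  then show ?case by (simp add: walk_betw_def walk_def)
next
  case (Cons x p)
  show ?case
  proof (cases "p = []")
    case True
    then show ?thesis using Cons.prems by (auto simp: walk_betw_def walk_def)
  next
    case False
    with Cons.prems have "walk_betw V E (hd p) p v" "{u, hd p} \<in> E" "u \<in> V"
      by (auto simp: walk_betw_def walk_Cons)
    with Cons.IH[of "hd p"] show ?thesis
      by (auto simp: adj_def intro: converse_rtranclp_into_rtranclp)
  qed
qed

text \<open>A path is extended at its front; if the new vertex already occurs on it, the part before
  that occurrence is dropped.\<close>

lemma adj_imp_path_betw:
  assumes "(adj V E)\<^sup>*\<^sup>* u v" "v \<in> V"
  shows "\<exists>p. path_betw V E u p v"
  using assms(1)
proof (induction rule: converse_rtranclp_induct)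
  case base
  have "path_betw V E v [v] v"
    using assms(2) by (simp add: path_betw_def walk_betw_def walk_def)
  then show ?case ..
next
  case (step x y)
  then obtain p where p: "path_betw V E y p v" by blast
  then have ne: "p \<noteq> []" by (auto simp: path_betw_def walk_betw_def walk_def)
  show ?case
  proof (cases "x \<in> set p")
    case True
    then obtain a b where "p = a @ x # b" by (meson split_list)
    with p have "path_betw V E x (x # b) v"
      by (auto simp: path_betw_def walk_betw_def dest: walk_append2)
    then show ?thesis ..
  next
    case False
    with p step.hyps(1) ne have "path_betw V E x (x # p) v"
      by (auto simp: path_betw_def walk_betw_def walk_Cons adj_def)
    then show ?thesis ..
  qed
qed

lemma ex_walk_betw_iff:
  "(\<exists>p. walk_betw V E u p v) \<longleftrightarrow> u \<in> V \<and> v \<in> V \<and> (adj V E)\<^sup>*\<^sup>* u v"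
  by (metis adj_imp_path_betw path_betw_def walk_betw_imp_adj)

lemma connected_graph_iff:
  "connected_graph V E \<longleftrightarrow> V \<noteq> {} \<and> (\<forall>u\<in>V. \<forall>v\<in>V. (adj V E)\<^sup>*\<^sup>* u v)"
  by (auto simp: connected_graph_def ex_walk_betw_iff)

lemma connected_graphI_root:
  assumes "r \<in> V" "\<And>v. v \<in> V \<Longrightarrow> (adj V E)\<^sup>*\<^sup>* v r"
  shows "connected_graph V E"
  unfolding connected_graph_iff
  using assms by (meson adj_rtranclp_sym empty_iff rtranclp_trans)

section \<open>Parent functions and acyclicity\<close>

text \<open>A rank function under which every edge joins a vertex to its parent excludes cycles.\<close>

definition parented :: "'a set set \<Rightarrow> ('a \<Rightarrow> 'a) \<Rightarrow> ('a \<Rightarrow> nat) \<Rightarrow> bool" where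
  "parented E par d \<longleftrightarrow>
     (\<forall>x y. {x, y} \<in> E \<longrightarrow> par x = y \<and> d y < d x \<or> par y = x \<and> d x < d y)"

lemma parented_mono: "parented E par d \<Longrightarrow> E' \<subseteq> E \<Longrightarrow> parented E' par d"
  by (auto simp: parented_def)

text \<open>A path that has stepped from a parent to a child can only continue to further children:
  the single parent of the current vertex has just been visited.\<close>

lemma parented_descend:
  assumes "parented E par d" "successively (\<lambda>u v. {u, v} \<in> E) (x # y # zs)"
    "distinct (x # y # zs)" "par y = x" "d x < d y"
  shows "d x < d (last (y # zs)) \<and> par (last (y # zs)) \<in> set (x # y # zs)"
  using assms(2-)
proof (induction zs arbitrary: x y)
  case Nil
  then show ?case by auto
next
  case (Cons z zs)
  have "{y, z} \<in> E" "x \<noteq> z" using Cons.prems by auto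
  then have "par z = y" "d y < d z"
    using assms(1) Cons.prems(3) unfolding parented_def by blast+
  then show ?case
    using Cons.IH[of y z] Cons.prems by auto
qed

text \<open>A first step to a child would make the rank rise until the end of the path, but the end
  has rank 0. So the first step goes to the parent.\<close>

lemma parented_path_to_root:
  assumes "parented E par d" "d r = 0" "j \<noteq> r" "path_betw V E j p r"
  shows "p ! 1 = par j"
proof -
  obtain y zs where p: "p = j # y # zs"
    using assms(3,4) unfolding path_betw_def walk_betw_def walk_def
    by (metis hd_conv_nth last_ConsL list.collapse)
  have s: "successively (\<lambda>u v. {u, v} \<in> E) (j # y # zs)" "distinct (j # y # zs)"
    and l: "last (y # zs) = r"
    using assms(4) by (auto simp: p path_betw_def walk_betw_def walk_def)
  have "\<not> (par y = j \<and> d j < d y)"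
    using parented_descend[OF assms(1) s] assms(2) l by auto
  then show ?thesis
    using s assms(1) unfolding parented_def p by fastforce
qed

text \<open>Otherwise ranks rise all the way from \<open>x\<close> to the last vertex, whose parent
  lies on the path after \<open>x\<close>. Then the closing edge joins neither end to its
  parent.\<close>

lemma parented_cycle_up:
  assumes "parented E par d" "cycle V E (x # y # z # zs)"
  shows "par x = y"
proof (rule ccontr)
  assume "par x \<noteq> y"
  have s: "successively (\<lambda>u v. {u, v} \<in> E) (x # y # z # zs)" "distinct (x # y # z # zs)"
    and e: "{last (z # zs), x} \<in> E"
    using assms(2) by (auto simp: cycle_def walk_def)
  then have E: "{x, y} \<in> E" "{y, z} \<in> E" "x \<noteq> z" by auto
  then have xy: "par y = x" "d x < d y"
    using \<open>par x \<noteq> y\<close> assms(1) unfolding parented_def by blast+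
  then have yz: "par z = y" "d y < d z"
    using E assms(1) unfolding parented_def by blast+
  have up: "d x < d (last (z # zs))"
    using parented_descend[OF assms(1) s xy] by simp
  have "par (last (z # zs)) \<in> set (y # z # zs)"
    using parented_descend[OF assms(1), of y z zs] s yz by simp
  with s(2) have "par (last (z # zs)) \<noteq> x" by auto
  with e up show False
    using assms(1) unfolding parented_def by (meson less_asym)
qed

text \<open>In both directions of traversal the first vertex has its successor as parent. So neither
  end of the closing edge is the parent of the other, because the vertices are distinct.\<close>

lemma parented_acyclic:
  assumes "parented E par d"
  shows "\<not> cycle V E p"
proof
  assume c: "cycle V E p"
  then have "length p \<ge> 3" by (simp add: cycle_def)
  then obtain x y z zs where p: "p = x # y # z # zs"
    by (auto simp: numeral_3_eq_3 Suc_le_length_iff)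
  have c': "cycle V E (rev p)"
    using c by (auto simp: cycle_def hd_rev last_rev insert_commute)
  from \<open>length p \<ge> 3\<close> have "length (rev p) \<ge> 3" by simp
  then obtain a b c cs where q: "rev p = a # b # c # cs"
    unfolding numeral_3_eq_3 Suc_le_length_iff by blast
  have "par x = y" "par a = b"
    using parented_cycle_up[OF assms] c c' p q by auto
  moreover have "par x = a \<or> par a = x"
  proof -
    have "a = last p" using q by (metis hd_rev list.sel(1))
    then have "{a, x} \<in> E" using c p by (simp add: cycle_def)
    then show ?thesis using assms unfolding parented_def by blast
  qed
  moreover have "a \<noteq> y"
  proof -
    have "a = last (z # zs)" using q p by (metis hd_rev list.sel(1) last.simps list.distinct(1))
    then show ?thesis using c p by (auto simp: cycle_def)
  qed
  moreover have "b \<noteq> x"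
  proof -
    have "x = last (c # cs)" using q p by (metis last_rev list.sel(1) last.simps list.distinct(1))
    then show ?thesis using c' q by (auto simp: cycle_def)
  qed
  ultimately show False by blast
qed

lemma components_tree:
  assumes "simple_graph V E" "parented E par d" "C \<in> components V E"
  shows "tree C (induced_edges E C)"
proof -
  obtain u where u: "u \<in> V" and C: "C = {v \<in> V. (adj V E)\<^sup>*\<^sup>* u v}"
    using assms(3) by (auto simp: components_def ex_walk_betw_iff)
  have "simple_graph C (induced_edges E C)"
    using assms(1) by (auto simp: simple_graph_def induced_edges_def)
  moreover have "(adj C (induced_edges E C))\<^sup>*\<^sup>* u v" if "(adj V E)\<^sup>*\<^sup>* u v" for v
    using that
  proof (induction rule: rtranclp_induct)
    case base
    then show ?case by simp
  next
    case (step y z)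
    \<comment> \<open>All vertices reached from \<open>u\<close> lie in \<open>C\<close>, so the
      walk uses only induced edges.\<close>
    then have "adj C (induced_edges E C) y z"
      by (auto simp: adj_def C induced_edges_def intro: rtranclp.rtrancl_into_rtrancl)
    with step.IH show ?case by simp
  qed
  then have "connected_graph C (induced_edges E C)"
    using u by (intro connected_graphI_root[of u]) (auto simp: C intro: adj_rtranclp_sym)
  moreover have "parented (induced_edges E C) par d"
    using assms(2) by (rule parented_mono) (auto simp: induced_edges_def)
  ultimately show ?thesis
    by (auto simp: tree_def dest: parented_acyclic)
qed

section \<open>The parent function of a rooted tree\<close>

text \<open>
  In a tree the edges to a neighbour closer to \<open>r\<close> already connect all vertices,
  so any further edge would close a cycle.
\<close>

lemma tree_parent_function:
  assumes "tree V E" "r \<in> V"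
  obtains q and d :: "'a \<Rightarrow> nat"
  where "\<And>j. j \<in> V - {r} \<Longrightarrow> q j \<in> V \<and> d (q j) < d j \<and> {j, q j} \<in> E
           \<and> (\<exists>p. path_betw V E j p r \<and> p ! 1 = q j)"
    and "E = (\<lambda>j. {j, q j}) ` (V - {r})"
proof -
  \<comment> \<open>The number of vertices on a shortest path to \<open>r\<close>; the second vertex
    of such a path serves as parent.\<close>
  define d where "d j = (LEAST n. \<exists>p. path_betw V E j p r \<and> length p = n)" for j
  have step: "\<exists>k. k \<in> V \<and> d k < d j \<and> {j, k} \<in> E \<and> (\<exists>p. path_betw V E j p r \<and> p ! 1 = k)"
    if j: "j \<in> V - {r}" for j
  proof -
    have "\<exists>p. path_betw V E j p r"
      using assms j adj_imp_path_betw by (metis DiffD1 connected_graph_iff tree_def)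
    then have "\<exists>n p. path_betw V E j p r \<and> length p = n" by blast
    then have "\<exists>p. path_betw V E j p r \<and> length p = d j"
      unfolding d_def by (rule LeastI_ex)
    then obtain p where p: "path_betw V E j p r" "length p = d j" by blast
    then obtain k ks where pk: "p = j # k # ks"
      using j unfolding path_betw_def walk_betw_def walk_def
      by (metis DiffD2 hd_conv_nth insertI1 last_ConsL list.collapse)
    then have "path_betw V E k (k # ks) r"
      using p by (auto simp: path_betw_def walk_betw_def walk_def)
    then have "d k \<le> length (k # ks)"
      unfolding d_def by (intro Least_le) blast
    then have "d k < d j" using p pk by simp
    moreover have "k \<in> V" "{j, k} \<in> E" "p ! 1 = k"
      using p pk by (auto simp: path_betw_def walk_betw_def walk_def)
    ultimately show ?thesis using p(1) by blast
  qed
  then obtain q where q: "\<And>j. j \<in> V - {r} \<Longrightarrow> q j \<in> V \<and> d (q j) < d j \<and> {j, q j} \<in> E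
           \<and> (\<exists>p. path_betw V E j p r \<and> p ! 1 = q j)"
    by metis
  define Q where "Q = (\<lambda>j. {j, q j}) ` (V - {r})"
  have QE: "Q \<subseteq> E" using q by (auto simp: Q_def)
  have to_root: "(adj V Q)\<^sup>*\<^sup>* j r" if "j \<in> V" for j
    using that
  proof (induction "d j" arbitrary: j rule: less_induct)
    case less
    show ?case
    proof (cases "j = r")
      case False
      with less q have "adj V Q j (q j)" "(adj V Q)\<^sup>*\<^sup>* (q j) r"
        by (auto simp: adj_def Q_def)
      then show ?thesis by (rule converse_rtranclp_into_rtranclp)
    qed simp
  qed
  have "E \<subseteq> Q"
  proof
    fix e assume e: "e \<in> E"
    then obtain i j where ij: "e = {i, j}" "i \<noteq> j" "i \<in> V" "j \<in> V"
      using assms(1) unfolding tree_def simple_graph_def by (metis card_2_iff insert_subset)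
    show "e \<in> Q"
    proof (rule ccontr)
      assume eQ: "e \<notin> Q"
      \<comment> \<open>A path inside \<open>Q\<close> avoids the edge \<open>e\<close>, which
        therefore closes it to a cycle in \<open>E\<close>.\<close>
      obtain p where p: "path_betw V Q i p j"
        using to_root ij adj_rtranclp_sym adj_imp_path_betw by (metis rtranclp_trans)
      have "length p \<ge> 3"
      proof (rule ccontr)
        assume "\<not> ?thesis"
        with p ij obtain x y where "p = [x, y]"
          unfolding path_betw_def walk_betw_def walk_def
          by (cases p rule: remdups_adj.cases) (auto simp: not_le numeral_3_eq_3)
        with p ij eQ show False
          by (auto simp: path_betw_def walk_betw_def walk_def)
      qed
      moreover have "walk V E p"
        using p QE unfolding path_betw_def walk_betw_def walk_def
        by (auto elim!: successively_mono)
      ultimately have "cycle V E p"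
        using p e ij by (auto simp: cycle_def path_betw_def walk_betw_def insert_commute)
      with assms(1) show False by (auto simp: tree_def)
    qed
  qed
  with QE q show thesis
    by (intro that[of q d]) (auto simp: Q_def)
qed

section \<open>Rooted forests as pairs of choices\<close>

lemma doubleton_in_reduced_edges:
  "{i, j} \<in> reduced_edges m V E \<longleftrightarrow>
     i \<in> {1..m} \<and> j \<in> {1..m} \<and> i \<noteq> j \<and> (\<exists>u\<in>V i. \<exists>v\<in>V j. {u, v} \<in> E)"
proof
  assume "{i, j} \<in> reduced_edges m V E"
  then obtain a b u v where "{i, j} = {a, b}" "a \<in> {1..m}" "b \<in> {1..m}" "a \<noteq> b"
    "u \<in> V a" "v \<in> V b" "{u, v} \<in> E"
    unfolding reduced_edges_def by blast
  then show "i \<in> {1..m} \<and> j \<in> {1..m} \<and> i \<noteq> j \<and> (\<exists>u\<in>V i. \<exists>v\<in>V j. {u, v} \<in> E)"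
    by (metis doubleton_eq_iff)
qed (auto simp: reduced_edges_def)

locale vertex_classes =
  fixes m :: nat and V :: "nat \<Rightarrow> 'a set"
  assumes m_pos: "m \<ge> 1"
    and disj: "disjoint_family_on V {1..m}"
    and fin: "\<And>i. i \<in> {1..m} \<Longrightarrow> finite (V i) \<and> V i \<noteq> {}"
begin

definition own :: "'a \<Rightarrow> nat" where
  "own u = (SOME i. i \<in> {1..m} \<and> u \<in> V i)"

text \<open>\<open>T i\<close> stands for the set of vertices of \<open>V i\<close> joined to the
  root \<open>f i\<close>. Extensionality makes \<open>T\<close> determined by its values on
  \<open>{2..m}\<close>.\<close>

definition choices :: "(nat \<Rightarrow> 'a set) set" where
  "choices = (\<Pi>\<^sub>E i\<in>{2..m}. Pow (V i) - {{}})"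

definition edges :: "(nat \<Rightarrow> 'a) \<Rightarrow> (nat \<Rightarrow> 'a set) \<Rightarrow> 'a set set" where
  "edges f T = {{f i, v} | i v. i \<in> {2..m} \<and> v \<in> T i}"

lemma own_eq: "i \<in> {1..m} \<Longrightarrow> u \<in> V i \<Longrightarrow> own u = i"
  unfolding own_def
  by (rule some_equality) (use disjoint_family_onD[OF disj] in blast)+

lemma doubleton_in_edges:
  "{x, y} \<in> edges f T \<longleftrightarrow> (\<exists>i\<in>{2..m}. x = f i \<and> y \<in> T i \<or> y = f i \<and> x \<in> T i)"
  unfolding edges_def doubleton_eq_iff mem_Collect_eq by blast

lemma choices_mem:
  assumes "T \<in> choices" "i \<in> {2..m}"
  shows "T i \<subseteq> V i" "T i \<noteq> {}"
  using assms PiE_mem[of T "{2..m}"] by (auto simp: choices_def)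

text \<open>The rank in \<open>attachments\<close> compares only indices from 2 on; shifting it by
  one makes room for the index 1 at rank 0.\<close>

lemma attachment_rank:
  assumes "f \<in> attachments V {2..m} (V 1)"
  obtains d :: "nat \<Rightarrow> nat" where "d 1 = 0"
    and "\<And>i. i \<in> {2..m} \<Longrightarrow> own (f i) \<in> {1..m} \<and> f i \<in> V (own (f i)) \<and> d (own (f i)) < d i"
proof -
  obtain d :: "nat \<Rightarrow> nat" where d: "\<forall>i\<in>{2..m}. \<forall>k\<in>{2..m}. f i \<in> V k \<longrightarrow> d k < d i"
    and f: "f \<in> {2..m} \<rightarrow>\<^sub>E V 1 \<union> \<Union> (V ` {2..m})"
    using assms unfolding attachments_def by blast
  define d' where "d' i = (if i = 1 then 0 else Suc (d i))" for i
  show thesis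
  proof (rule that[of d'])
    fix i assume i: "i \<in> {2..m}"
    with PiE_mem[OF f i] obtain k where k: "k = 1 \<or> k \<in> {2..m}" "f i \<in> V k" by blast
    then have "k \<in> {1..m}" using m_pos by auto
    with k own_eq have "own (f i) = k" by blast
    with k d i \<open>k \<in> {1..m}\<close> show "own (f i) \<in> {1..m} \<and> f i \<in> V (own (f i)) \<and> d' (own (f i)) < d' i"
      by (auto simp: d'_def)
  qed (simp add: d'_def)
qed

section \<open>From choices to rooted forests and back\<close>

lemma reduced_edges_edges:
  assumes f: "f \<in> attachments V {2..m} (V 1)" and T: "T \<in> choices"
  shows "reduced_edges m V (edges f T) = (\<lambda>i. {own (f i), i}) ` {2..m}"
proof (intro equalityI subsetI)
  fix e assume "e \<in> reduced_edges m V (edges f T)"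
  then obtain i j u v where e: "e = {i, j}" "i \<in> {1..m}" "j \<in> {1..m}" "u \<in> V i" "v \<in> V j"
    "{u, v} \<in> edges f T"
    unfolding reduced_edges_def by blast
  then obtain k where k: "k \<in> {2..m}" "u = f k \<and> v \<in> T k \<or> v = f k \<and> u \<in> T k"
    unfolding doubleton_in_edges by blast
  then have "k \<in> {1..m}" by auto
  then have "own w = k" if "w \<in> T k" for w
    using choices_mem(1)[OF T k(1)] that own_eq by blast
  then have "e = {own (f k), k}"
    using k(2) e own_eq by (metis insert_commute)
  then show "e \<in> (\<lambda>i. {own (f i), i}) ` {2..m}" using k by blast
next
  fix e assume "e \<in> (\<lambda>i. {own (f i), i}) ` {2..m}"
  then obtain i where i: "i \<in> {2..m}" "e = {own (f i), i}" by blast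
  obtain d :: "nat \<Rightarrow> nat" where d: "own (f i) \<in> {1..m}" "f i \<in> V (own (f i))" "d (own (f i)) < d i"
    using attachment_rank[OF f] i(1) by metis
  \<comment> \<open>Non-emptiness of \<open>T i\<close> guarantees that the link from
    \<open>i\<close> to its parent index occurs in the reduced graph.\<close>
  obtain v where "v \<in> T i" using choices_mem(2)[OF T i(1)] by blast
  then have "v \<in> V i" "{f i, v} \<in> edges f T"
    using choices_mem(1)[OF T i(1)] i(1) by (auto simp: edges_def)
  then show "e \<in> reduced_edges m V (edges f T)"
    using d i by (auto simp: doubleton_in_reduced_edges)
qed

text \<open>Both graphs have parent functions, \<open>own (f i)\<close> for indices and
  \<open>f (own v)\<close> for vertices, with the same rank, so both are acyclic. The reduced graph
  is connected because the parents lead down to 1.\<close>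

lemma rooted_forest_edges:
  assumes f: "f \<in> attachments V {2..m} (V 1)" and T: "T \<in> choices"
  shows "rooted_forest m V (edges f T)"
proof -
  obtain d :: "nat \<Rightarrow> nat" where d1: "d 1 = 0"
    and d: "\<And>i. i \<in> {2..m} \<Longrightarrow> own (f i) \<in> {1..m} \<and> f i \<in> V (own (f i)) \<and> d (own (f i)) < d i"
    using attachment_rank[OF f] by blast
  let ?U = "\<Union>i\<in>{1..m}. V i" and ?E = "edges f T" and ?R = "reduced_edges m V (edges f T)"
  have ownT: "own v = i" "v \<in> V i" if "i \<in> {2..m}" "v \<in> T i" for i v
  proof -
    show "v \<in> V i" using choices_mem(1)[OF T] that by blast
    moreover have "i \<in> {1..m}" using that by auto
    ultimately show "own v = i" by (rule own_eq[rotated])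
  qed
  have simple: "simple_graph ?U ?E"
    unfolding simple_graph_def
  proof
    fix e assume "e \<in> ?E"
    then obtain i v where e: "e = {f i, v}" "i \<in> {2..m}" "v \<in> T i" by (auto simp: edges_def)
    then have "f i \<noteq> v" using d[of i] ownT[of i v] by auto
    moreover have "f i \<in> ?U" "v \<in> ?U" using d[of i] ownT[of i v] e by auto
    ultimately show "e \<subseteq> ?U \<and> card e = 2" using e by simp
  qed
  have pE: "parented ?E (\<lambda>v. f (own v)) (\<lambda>v. d (own v))"
    unfolding parented_def doubleton_in_edges using d ownT by blast
  have R: "?R = (\<lambda>i. {own (f i), i}) ` {2..m}"
    by (rule reduced_edges_edges[OF f T])
  have pR: "parented ?R (\<lambda>i. own (f i)) d"
    unfolding parented_def
  proof (intro allI impI)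
    fix x y assume "{x, y} \<in> ?R"
    then obtain i where "i \<in> {2..m}" "{x, y} = {own (f i), i}" unfolding R by blast
    then show "own (f x) = y \<and> d y < d x \<or> own (f y) = x \<and> d x < d y"
      using d[of i] by (auto simp: doubleton_eq_iff)
  qed
  have to_root: "(adj {1..m} ?R)\<^sup>*\<^sup>* j 1" if "j \<in> {1..m}" for j
    using that
  proof (induction "d j" arbitrary: j rule: less_induct)
    case less
    show ?case
    proof (cases "j = 1")
      case False
      with less have j: "j \<in> {2..m}" by auto
      then have "adj {1..m} ?R j (own (f j))"
        using d[OF j] less.prems unfolding adj_def R by (auto simp: insert_commute)
      then show ?thesis
        using less.hyps d[OF j] by (blast intro: converse_rtranclp_into_rtranclp)
    qed simp
  qed
  have "tree {1..m} ?R"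
    unfolding tree_def
  proof (intro conjI notI)
    show "simple_graph {1..m} ?R"
      unfolding simple_graph_def
    proof
      fix e assume "e \<in> ?R"
      then obtain i where i: "i \<in> {2..m}" "e = {own (f i), i}" unfolding R by blast
      then have "own (f i) \<noteq> i" using d[of i] by auto
      then show "e \<subseteq> {1..m} \<and> card e = 2" using d[of i] i by auto
    qed
    show "connected_graph {1..m} ?R"
      using m_pos to_root by (intro connected_graphI_root[of 1]) auto
    show False if "\<exists>p. cycle {1..m} ?R p"
      using that parented_acyclic[OF pR] by blast
  qed
  moreover have "\<exists>r\<in>V (p ! 1). \<forall>u\<in>V (p ! 1). \<forall>v\<in>V j. {u, v} \<in> ?E \<longrightarrow> u = r"
    if j: "j \<in> {2..m}" and p: "path_betw {1..m} ?R j p 1" for j p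
  proof -
    have p1: "p ! 1 = own (f j)"
      using parented_path_to_root[OF pR d1 _ p] j by auto
    have "u = f j" if uv: "u \<in> V (own (f j))" "v \<in> V j" "{u, v} \<in> ?E" for u v
    proof -
      have own: "own u = own (f j)" "own v = j"
        using uv j d[OF j] own_eq by auto
      obtain k where k: "k \<in> {2..m}" "u = f k \<and> v \<in> T k \<or> v = f k \<and> u \<in> T k"
        using uv(3) unfolding doubleton_in_edges by blast
      from k(2) show ?thesis
      proof
        assume "u = f k \<and> v \<in> T k"
        then show ?thesis using ownT k(1) own by metis
      next
        \<comment> \<open>The opposite orientation would make \<open>j\<close> and \<open>k\<close>
          parents of each other, against the rank.\<close>
        assume "v = f k \<and> u \<in> T k"
        then have "k = own (f j)" "own (f k) = j" using ownT k(1) own by auto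
        then show ?thesis using d[OF k(1)] d[OF j] by auto
      qed
    qed
    then show ?thesis unfolding p1 using d[OF j] by blast
  qed
  moreover have "{u, v} \<notin> ?E" if "j \<in> {1..m}" "u \<in> V j" "v \<in> V j" for j u v
  proof
    assume "{u, v} \<in> ?E"
    moreover have "own u = j" "own v = j" using that own_eq by auto
    \<comment> \<open>The ends of an edge have different ranks, whereas vertices of one class share
      their rank.\<close>
    ultimately show False
      using pE unfolding parented_def by fastforce
  qed
  ultimately show ?thesis
    unfolding rooted_forest_def using simple components_tree[OF simple pE] by blast
qed

text \<open>The reduced tree supplies the parent index \<open>q j\<close>, the root condition the
  vertex \<open>f j\<close> in \<open>V (q j)\<close>, and \<open>T j\<close> collects the
  neighbours of \<open>f j\<close> in \<open>V j\<close>.\<close>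

lemma rooted_forest_obtains:
  assumes E: "rooted_forest m V E"
  obtains f T where "f \<in> attachments V {2..m} (V 1)" "T \<in> choices" "E = edges f T"
proof -
  let ?R = "reduced_edges m V E"
  have tree: "tree {1..m} ?R" using E by (simp add: rooted_forest_def)
  have A: "{1..m} - {1} = {2..m}" by auto
  obtain q and d :: "nat \<Rightarrow> nat"
    where q: "\<And>j. j \<in> {2..m} \<Longrightarrow> q j \<in> {1..m} \<and> d (q j) < d j \<and> {j, q j} \<in> ?R
           \<and> (\<exists>p. path_betw {1..m} ?R j p 1 \<and> p ! 1 = q j)"
      and R: "?R = (\<lambda>j. {j, q j}) ` {2..m}"
    using tree_parent_function[OF tree, of 1] m_pos unfolding A by auto
  have "\<exists>r\<in>V (q j). \<forall>u\<in>V (q j). \<forall>v\<in>V j. {u, v} \<in> E \<longrightarrow> u = r" if j: "j \<in> {2..m}" for j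
  proof -
    obtain p where "path_betw {1..m} ?R j p 1" and p1: "p ! 1 = q j" using q[OF j] by blast
    then have "\<exists>r\<in>V (p ! 1). \<forall>u\<in>V (p ! 1). \<forall>v\<in>V j. {u, v} \<in> E \<longrightarrow> u = r"
      using E j unfolding rooted_forest_def by blast
    then show ?thesis unfolding p1 .
  qed
  then obtain f0 where f0: "\<And>j. j \<in> {2..m} \<Longrightarrow> f0 j \<in> V (q j) \<and>
      (\<forall>u\<in>V (q j). \<forall>v\<in>V j. {u, v} \<in> E \<longrightarrow> u = f0 j)"
    by metis
  define f where "f = restrict f0 {2..m}"
  define T where "T = (\<lambda>j\<in>{2..m}. {v \<in> V j. {f j, v} \<in> E})"
  have f: "f j \<in> V (q j)" "\<And>u v. u \<in> V (q j) \<Longrightarrow> v \<in> V j \<Longrightarrow> {u, v} \<in> E \<Longrightarrow> u = f j"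
    if "j \<in> {2..m}" for j
    using f0[OF that] that by (auto simp: f_def)
  have "f \<in> attachments V {2..m} (V 1)"
  proof -
    have "f \<in> {2..m} \<rightarrow>\<^sub>E V 1 \<union> \<Union> (V ` {2..m})"
    proof (rule PiE_I)
      fix j assume j: "j \<in> {2..m}"
      then have "q j = 1 \<or> q j \<in> {2..m}" using q[OF j] by auto
      then show "f j \<in> V 1 \<union> \<Union> (V ` {2..m})" using f(1)[OF j] by auto
    qed (auto simp: f_def)
    moreover have "d k < d j" if "j \<in> {2..m}" "k \<in> {2..m}" "f j \<in> V k" for j k
    proof -
      have "k \<in> {1..m}" using that by auto
      \<comment> \<open>By disjointness \<open>f j\<close> lies in no class but
        \<open>V (q j)\<close>, so the rank of the reduced tree also serves
        \<open>f\<close>.\<close>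
      then have "k = q j" using own_eq that f(1) q by metis
      then show ?thesis using q that by blast
    qed
    ultimately show ?thesis unfolding attachments_def by blast
  qed
  moreover have "T \<in> choices"
    unfolding choices_def
  proof (rule PiE_I)
    fix j assume j: "j \<in> {2..m}"
    then have "{q j, j} \<in> ?R" using q by (simp add: insert_commute)
    then obtain u v where "u \<in> V (q j)" "v \<in> V j" "{u, v} \<in> E"
      unfolding doubleton_in_reduced_edges by blast
    \<comment> \<open>The edge behind the reduced edge must start at \<open>f j\<close>, which gives
      an element of \<open>T j\<close>.\<close>
    with f(2)[OF j] have "v \<in> T j" using j by (auto simp: T_def)
    then show "T j \<in> Pow (V j) - {{}}" using j by (auto simp: T_def)
  qed (auto simp: T_def)
  moreover have "E = edges f T"
  proof (intro equalityI subsetI)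
    fix e assume e: "e \<in> E"
    then have "e \<subseteq> (\<Union>i\<in>{1..m}. V i)" "card e = 2"
      using E by (auto simp: rooted_forest_def simple_graph_def)
    then obtain u v i j where uv: "e = {u, v}" "i \<in> {1..m}" "j \<in> {1..m}" "u \<in> V i" "v \<in> V j"
      by (auto simp: card_2_iff)
    then have "i \<noteq> j" using E e by (auto simp: rooted_forest_def)
    then have "{i, j} \<in> ?R" using uv e unfolding doubleton_in_reduced_edges by blast
    \<comment> \<open>This orients \<open>e\<close>: one end lies in the parent class
      \<open>V (q k)\<close> and so equals \<open>f k\<close>.\<close>
    then obtain k where k: "k \<in> {2..m}" "{i, j} = {k, q k}" unfolding R by blast
    then obtain x y where xy: "e = {x, y}" "x \<in> V (q k)" "y \<in> V k"
      using uv by (metis doubleton_eq_iff)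
    then have "x = f k" using f(2) e k by blast
    then show "e \<in> edges f T"
      using xy e k(1) by (auto simp: edges_def T_def)
  qed (auto simp: edges_def T_def)
  ultimately show thesis by (rule that)
qed

section \<open>Injectivity of the encoding\<close>

text \<open>
  The orientation of the edges can be recovered by moving away from \<open>V 1\<close>:
  if the two parent functions first differed at \<open>j\<close>, then the parent of \<open>j\<close> would have \<open>j\<close> as its own parent.
\<close>

lemma edges_inject:
  assumes f: "f \<in> attachments V {2..m} (V 1)" and T: "T \<in> choices"
    and g: "g \<in> attachments V {2..m} (V 1)" and S: "S \<in> choices"
    and eq: "edges f T = edges g S"
  shows "f = g \<and> T = S"
proof -
  have ownT: "own v = i" if "T \<in> choices" "i \<in> {2..m}" "v \<in> T i" for T i v
  proof -
    have "i \<in> {1..m}" "v \<in> V i" using choices_mem(1)[OF that(1,2)] that(2,3) by auto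
    then show ?thesis by (rule own_eq)
  qed
  obtain d :: "nat \<Rightarrow> nat"
    where d: "\<And>i. i \<in> {2..m} \<Longrightarrow> own (f i) \<in> {1..m} \<and> f i \<in> V (own (f i)) \<and> d (own (f i)) < d i"
    using attachment_rank[OF f] by blast
  have fg: "f j = g j" if "j \<in> {2..m}" for j
    using that
  proof (induction "d j" arbitrary: j rule: less_induct)
    case less
    obtain v where v: "v \<in> T j" using choices_mem(2)[OF T less.prems] by blast
    then have "{f j, v} \<in> edges g S"
      unfolding eq[symmetric] doubleton_in_edges using less.prems by blast
    then obtain k where k: "k \<in> {2..m}" "f j = g k \<and> v \<in> S k \<or> v = g k \<and> f j \<in> S k"
      unfolding doubleton_in_edges by blast
    from k(2) show ?case
    proof
      assume "f j = g k \<and> v \<in> S k"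
      then show ?thesis using ownT[OF S k(1)] ownT[OF T less.prems v] by metis
    next
      assume *: "v = g k \<and> f j \<in> S k"
      then have "own (f j) = k" "own (g k) = j"
        using ownT[OF S k(1)] ownT[OF T less.prems v] by auto
      \<comment> \<open>By induction \<open>f k = g k\<close>, which lies in \<open>V j\<close>;
        then \<open>d j < d k\<close> as well, a contradiction.\<close>
      moreover have "d k < d j" using d[OF less.prems] calculation by simp
      moreover have "f k = g k" using less.hyps k(1) calculation by blast
      ultimately show ?thesis using d[OF k(1)] by auto
    qed
  qed
  \<comment> \<open>Stated for arbitrary \<open>T\<close> and \<open>S\<close> so that exchanging
    them gives equality.\<close>
  have sub: "T j \<subseteq> S j"
    if T: "T \<in> choices" and S: "S \<in> choices" and eq: "edges f T = edges f S" and j: "j \<in> {2..m}"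
    for T S j
  proof
    fix v assume v: "v \<in> T j"
    then have "{f j, v} \<in> edges f S"
      unfolding eq[symmetric] doubleton_in_edges using j by blast
    then obtain k where k: "k \<in> {2..m}" "f j = f k \<and> v \<in> S k \<or> v = f k \<and> f j \<in> S k"
      unfolding doubleton_in_edges by blast
    from k(2) show "v \<in> S j"
    proof
      assume "f j = f k \<and> v \<in> S k"
      then show ?thesis using ownT[OF S k(1)] ownT[OF T j v] by metis
    next
      assume "v = f k \<and> f j \<in> S k"
      then have "own (f j) = k" "own (f k) = j"
        using ownT[OF S k(1)] ownT[OF T j v] by auto
      then show ?thesis using d[OF k(1)] d[OF j] by auto
    qed
  qed
  have "f = g"
    using f g fg by (intro PiE_ext[of f "{2..m}" _ g]) (auto simp: attachments_def)
  moreover have "T = S"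
  proof (rule PiE_ext)
    show "T \<in> (\<Pi>\<^sub>E i\<in>{2..m}. Pow (V i) - {{}})" "S \<in> (\<Pi>\<^sub>E i\<in>{2..m}. Pow (V i) - {{}})"
      using T S by (auto simp: choices_def)
    show "T j = S j" if "j \<in> {2..m}" for j
      using sub[OF T S _ that] sub[OF S T _ that] eq \<open>f = g\<close> by auto
  qed
  ultimately show ?thesis by blast
qed

section \<open>Counting\<close>

lemma card_rooted_forests:
  "card {E. rooted_forest m V E} = card (attachments V {2..m} (V 1)) * card choices"
proof -
  have "bij_betw (\<lambda>(f, T). edges f T) (attachments V {2..m} (V 1) \<times> choices) {E. rooted_forest m V E}"
    unfolding bij_betw_def
  proof
    show "inj_on (\<lambda>(f, T). edges f T) (attachments V {2..m} (V 1) \<times> choices)"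
    proof (rule inj_onI, clarify)
      fix f T g S
      assume "f \<in> attachments V {2..m} (V 1)" "T \<in> choices"
        "g \<in> attachments V {2..m} (V 1)" "S \<in> choices" "edges f T = edges g S"
      then show "f = g \<and> T = S" by (rule edges_inject)
    qed
    show "(\<lambda>(f, T). edges f T) ` (attachments V {2..m} (V 1) \<times> choices) = {E. rooted_forest m V E}"
    proof (intro equalityI subsetI)
      fix E assume "E \<in> {E. rooted_forest m V E}"
      then obtain f T where "f \<in> attachments V {2..m} (V 1)" "T \<in> choices" "E = edges f T"
        using rooted_forest_obtains by blast
      then show "E \<in> (\<lambda>(f, T). edges f T) ` (attachments V {2..m} (V 1) \<times> choices)"
        by (intro image_eqI[of _ _ "(f, T)"]) auto
    qed (clarify, rule rooted_forest_edges)
  qed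
  then show ?thesis
    by (simp add: bij_betw_same_card[symmetric] card_cartesian_product)
qed

lemma card_choices: "real (card choices) = (\<Prod>i=2..m. 2 ^ card (V i) - 1)"
proof -
  have "card (Pow (V i) - {{}}) = 2 ^ card (V i) - 1" if "i \<in> {2..m}" for i
    using fin[of i] that by (simp add: card_Diff_subset card_Pow)
  then have "card choices = (\<Prod>i=2..m. 2 ^ card (V i) - 1)"
    by (simp add: choices_def card_PiE)
  then show ?thesis by (simp add: of_nat_diff)
qed

end

theorem theorem2:
  fixes m :: nat and V :: "nat \<Rightarrow> 'a set"
  assumes "m \<ge> 1"
    and "disjoint_family_on V {1..m}"
    and "\<And>i. i \<in> {1..m} \<Longrightarrow> finite (V i) \<and> V i \<noteq> {}"
  shows "real (card {E. rooted_forest m V E}) =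
    real (card (V 1)) * real (\<Sum>i=1..m. card (V i)) powi (int m - 2) *
      (\<Prod>i=2..m. (2 ^ card (V i) - 1))"
proof -
  interpret vertex_classes m V
    using assms by unfold_locales
  define n where "n = (\<Sum>i=1..m. card (V i))"
  have n: "n = card (V 1) + (\<Sum>i=2..m. card (V i))"
    unfolding n_def using \<open>m \<ge> 1\<close> by (simp add: sum.atLeast_Suc_atMost numeral_2_eq_2)
  have "card (V 1) > 0" using assms(1,3) by (simp add: card_gt_0_iff)
  then have "n > 0" using n by simp
  have "V 1 \<inter> V i = {}" if "i \<in> {2..m}" for i
    using disjoint_family_onD[OF assms(2), of 1 i] that by auto
  then have "card (attachments V {2..m} (V 1)) * n = card (V 1) * n ^ (m - 1)"
    using card_attachments[of "{2..m}" V "V 1"] assms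
    by (simp add: n disjoint_family_on_def)
  then have "real (card (attachments V {2..m} (V 1))) * real n = real (card (V 1)) * real n ^ (m - 1)"
    by (metis of_nat_mult of_nat_power)
  \<comment> \<open>For \<open>m = 1\<close> the exponent is -1; since \<open>n\<close> is positive,
    one factor \<open>n\<close> can be absorbed and later cancelled.\<close>
  moreover have "real n powi (int m - 2) * real n = real n ^ (m - 1)"
  proof -
    have "real n powi (int m - 2) * real n = real n powi ((int m - 2) + 1)"
      using \<open>n > 0\<close> by (subst power_int_add) auto
    also have "(int m - 2) + 1 = int (m - 1)" using \<open>m \<ge> 1\<close> by simp
    finally show ?thesis by simp
  qed
  ultimately have "real (card (attachments V {2..m} (V 1)))
      = real (card (V 1)) * real n powi (int m - 2)"
    using \<open>n > 0\<close> by (metis mult.assoc mult_cancel_right of_nat_0_less_iff less_irrefl)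
  then show ?thesis
    by (simp add: card_rooted_forests card_choices n_def)
qed

end
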